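(* There is a constant $c$ such that for all integers $m \geq 1$ and $k \ge 2$, $$sr(m,k) \leq c\, m k^2 \log k.$$
   Context: For a positive integer $n$, $[n]=\{1,\dots,n\}$; $\log$ denotes the natural logarithm. In a coloring of $[n]$, an arithmetic progression is rainbow if its elements all have different colors. A $k$-term arithmetic progression is a set $\{a,a+d,\dots,a+(k-1)d\}$ with $d\ge 1$. The sub-Ramsey number $sr(m,k)$ is the minimum $n$ such that every coloring of $[n]$ in which no color is used more than $m$ times has a rainbow $k$-term arithmetic progression. *)

theory Defs
  imports Complex_Main
begin

definition arith_prog :: "nat \<Rightarrow> nat set \<Rightarrow> bool" where
  "arith_prog k A \<longleftrightarrow> (\<exists>a d. d \<ge> 1 \<and> A = (\<lambda>i. a + i * d) ` {..<k})"

definition rainbow :: "(nat \<Rightarrow> 'c) \<Rightarrow> nat set \<Rightarrow> bool" where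
  "rainbow col A \<longleftrightarrow> inj_on col A"

definition bounded_coloring :: "nat \<Rightarrow> nat \<Rightarrow> (nat \<Rightarrow> 'c) \<Rightarrow> bool" where
  "bounded_coloring m n col \<longleftrightarrow> (\<forall>x. card {i \<in> {1..n}. col i = x} \<le> m)"

text \<open>Since only the colors of the finitely many elements of \<open>{1..n}\<close> matter, taking the
  colors to be natural numbers loses no generality.\<close>

definition forces_rainbow_ap :: "nat \<Rightarrow> nat \<Rightarrow> nat \<Rightarrow> bool" where
  "forces_rainbow_ap m k n \<longleftrightarrow>
     (\<forall>col :: nat \<Rightarrow> nat. bounded_coloring m n col \<longrightarrow>
        (\<exists>A \<subseteq> {1..n}. arith_prog k A \<and> rainbow col A))"

definition sr :: "nat \<Rightarrow> nat \<Rightarrow> nat" where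
  "sr m k = (LEAST n. forces_rainbow_ap m k n)"

text \<open>The minimum is attained for all \<open>m\<close> and \<open>k\<close>, so \<open>sr\<close> never takes an unspecified value.\<close>

lemma forces_rainbow_ap_exists: "\<exists>n. forces_rainbow_ap m k n"
proof -
  define N where "N = k ^ 2 * ((k + 1) * m) + 1"
  define n where "n = (k + 1) * N"
  have "\<exists>A \<subseteq> {1..n}. arith_prog k A \<and> rainbow col A"
    if b: "bounded_coloring m n col" for col :: "nat \<Rightarrow> nat"
  proof (rule ccontr)
    assume none: "\<not> ?thesis"
    define S where "S = {1..N} \<times> {1..N}"
    define M where "M = (SIGMA x:{1..n}. {y \<in> {1..n}. col y = col x})"
    define B where "B = (\<lambda>(i, j). {(a, d) \<in> S. col (a + i * d) = col (a + j * d)})"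
    define P where "P = {(i, j). i < k \<and> j < k \<and> i \<noteq> j}"
    have P_sub: "P \<subseteq> {..<k} \<times> {..<k}" by (auto simp: P_def)
    have fP: "finite P" by (rule finite_subset[OF P_sub]) simp
    have cP: "card P \<le> k ^ 2"
      using card_mono[OF _ P_sub] by (simp add: power2_eq_square)
    have in_n: "a + i * d \<in> {1..n}" if "(a, d) \<in> S" "i < k" for a d i
    proof -
      have "a \<le> N" "1 \<le> a" "d \<le> N" using that by (auto simp: S_def)
      moreover have "i * d \<le> k * N" using that \<open>d \<le> N\<close> by (intro mult_le_mono) auto
      ultimately show ?thesis by (simp add: n_def)
    qed
    have "S \<subseteq> (\<Union>p\<in>P. B p)"
    proof clarify
      fix a d assume ad: "(a, d) \<in> S"
      let ?A = "(\<lambda>i. a + i * d) ` {..<k}"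
      have "?A \<subseteq> {1..n}" using in_n[OF ad] by blast
      moreover have "arith_prog k ?A"
        using ad by (auto simp: arith_prog_def S_def)
      ultimately have "\<not> inj_on col ?A" using none by (auto simp: rainbow_def)
      then obtain i j where "i < k" "j < k" "a + i * d \<noteq> a + j * d"
        "col (a + i * d) = col (a + j * d)" by (auto simp: inj_on_def)
      then have "(i, j) \<in> P" "(a, d) \<in> B (i, j)" using ad by (auto simp: P_def B_def)
      then show "(a, d) \<in> (\<Union>p\<in>P. B p)" by blast
    qed
    moreover have fS: "finite S" by (simp add: S_def)
    have fB: "finite (B p)" for p
      by (rule finite_subset[OF _ fS]) (auto simp: B_def split: prod.splits)
    ultimately have "card S \<le> card (\<Union>p\<in>P. B p)" using fP by (intro card_mono) auto
    also have "\<dots> \<le> (\<Sum>p\<in>P. card (B p))" by (rule card_UN_le[OF fP])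
    also have "\<dots> \<le> (\<Sum>p\<in>P. n * m)"
    proof (rule sum_mono)
      fix p assume "p \<in> P"
      then obtain i j where p: "p = (i, j)" "i < k" "j < k" "i \<noteq> j" by (auto simp: P_def)
      let ?f = "\<lambda>(a, d). (a + i * d, a + j * d)"
      have eq: "a = a' \<and> d = d'"
        if e: "a + i * d = a' + i * d'" "a + j * d = a' + j * d'" for a d a' d' :: nat
      proof -
        have "int (a + i * d) = int (a' + i * d')" "int (a + j * d) = int (a' + j * d')"
          using e by simp_all
        then have "(int i - int j) * (int d - int d') = 0" by (simp add: algebra_simps)
        then have "d = d'" using p by simp
        then show ?thesis using e by simp
      qed
      have "inj_on ?f (B p)"
      proof (rule inj_onI, clarify)
        fix a d a' d' assume "a + i * d = a' + i * d'" "a + j * d = a' + j * d'"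
        then show "a = a' \<and> d = d'" by (rule eq)
      qed
      moreover have "?f ` B p \<subseteq> M"
      proof clarify
        fix a d assume "(a, d) \<in> B p"
        then have ad: "(a, d) \<in> S" "col (a + i * d) = col (a + j * d)"
          by (auto simp: B_def p(1))
        show "(a + i * d, a + j * d) \<in> M"
          using in_n[OF ad(1) p(2)] in_n[OF ad(1) p(3)] ad(2) by (simp add: M_def)
      qed
      moreover have "finite M" by (simp add: M_def)
      ultimately have "card (B p) \<le> card M" by (rule card_inj_on_le)
      also have "card M = (\<Sum>x\<in>{1..n}. card {y \<in> {1..n}. col y = col x})"
        unfolding M_def by (rule card_SigmaI) auto
      also have "\<dots> \<le> (\<Sum>x\<in>{1..n}. m)"
        using b unfolding bounded_coloring_def by (intro sum_mono) blast
      finally show "card (B p) \<le> n * m" by simp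
    qed
    also have "\<dots> \<le> k ^ 2 * (n * m)" using cP by simp
    also have "\<dots> = (k ^ 2 * ((k + 1) * m)) * N" by (simp add: n_def algebra_simps)
    also have "\<dots> < N * N" by (simp add: N_def)
    finally show False by (simp add: S_def)
  qed
  then show ?thesis unfolding forces_rainbow_ap_def by blast
qed

end

theory Submission
  imports Defs "HOL-Analysis.Harmonic_Numbers" "HOL-Computational_Algebra.Primes"
begin

text \<open>
  Call \<open>d\<close> \<open>k\<close>-rough if no prime below \<open>k\<close> divides it, and count only the progressions
  \<open>a, a + d, \<dots>, a + (k - 1) d\<close> inside \<open>{1..n}\<close> whose difference \<open>d \<le> X\<close> is rough, where
  \<open>n = 2 k X\<close> and \<open>a \<le> k X\<close>.  If two terms \<open>x < y\<close> of such a progression have the same color,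
  then \<open>y - x = j d\<close> with \<open>0 < j < k\<close>.  All prime factors of \<open>j\<close> are below \<open>k\<close>, so \<open>d\<close> is
  determined by \<open>y - x\<close>: it is the largest rough divisor.  Hence a pair \<open>x, y\<close> spoils at most
  \<open>k\<close> of these progressions (one for each position of \<open>x\<close>), and since there are at most \<open>n m\<close>
  pairs of equal color, a rainbow progression exists as soon as the number \<open>k X |S|\<close> of
  progressions exceeds \<open>n m k\<close>, that is, \<open>|S| > 2 m k\<close>, where \<open>S\<close> is the set of rough
  \<open>d \<le> X\<close> (\<open>forces_rainbow_ap_if_many_rough\<close>).

  It remains to see that the rough numbers up to \<open>X\<close> have density at least a constant over
  \<open>ln k\<close> once \<open>X\<close> is at least a large constant times \<open>k ln k\<close> (\<open>card_rough_ge\<close>); then \<open>X\<close> of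
  order \<open>m k ln k\<close> suffices.  The products \<open>r p\<close> of a rough \<open>r \<le> Y\<close>, where \<open>Y\<close> is about the
  cube root of \<open>X\<close>, and a prime \<open>p \<le> X / r\<close> above both \<open>Y\<close> and \<open>k\<close> are rough and pairwise
  distinct.  By Chebyshev's lower bound for the number of primes, there are at least a constant
  times \<open>X / ln X\<close> times the sum of \<open>1 / r\<close> over the rough \<open>r \<le> Y\<close> of them.

  That sum is at least a constant times \<open>ln Y / ln k\<close> (\<open>sum_inverse_rough_ge\<close>), which makes
  \<open>ln X\<close> cancel.  The reason is that every \<open>n\<close> is the product of its smooth part (composed of
  primes below \<open>k\<close>) and a rough number.  With weights \<open>1 / n\<close> on \<open>{1..Y}\<close> the mean logarithm
  of the smooth part is at most \<open>4 ln k\<close>, so by Markov's inequality at least half of the weight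
  \<open>harm Y\<close> lies on numbers whose smooth part is at most \<open>k ^ 8\<close>, and that weight is at most the
  sum of \<open>1 / r\<close> times \<open>harm (k ^ 8)\<close>, which is \<open>O(ln k)\<close>.
\<close>

section \<open>Chebyshev's lower bound\<close>

lemma card_powers_dvd:
  fixes p m N :: nat
  assumes "prime p" "0 < m" "m \<le> N"
  shows "(\<Sum>a\<in>{1..N}. of_bool (p ^ a dvd m)) = multiplicity p m"
proof -
  have p: "p \<ge> 2" "\<not> is_unit p" using assms(1) prime_ge_2_nat by auto
  have "multiplicity p m < 2 ^ multiplicity p m" by (rule less_exp)
  also have "\<dots> \<le> p ^ multiplicity p m" using p by (intro power_mono) auto
  also have "\<dots> \<le> m" using assms by (intro dvd_imp_le multiplicity_dvd)
  finally have v: "multiplicity p m \<le> N" using assms by simp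
  have "(\<Sum>a\<in>{1..N}. of_bool (p ^ a dvd m)) = card {a \<in> {1..N}. p ^ a dvd m}"
    by (simp add: of_bool_def sum.If_cases Int_def)
  also have "{a \<in> {1..N}. p ^ a dvd m} = {1..multiplicity p m}"
    using v p assms(2) by (auto simp: power_dvd_iff_le_multiplicity)
  finally show ?thesis by simp
qed

text \<open>Legendre's formula; the terms with \<open>n < p ^ a\<close> vanish, so any upper limit
  \<open>N \<ge> n\<close> for the exponent gives the same sum.  The freedom in \<open>N\<close> lets factorials of different
  numbers be compared termwise.\<close>

lemma multiplicity_fact:
  fixes p n N :: nat
  assumes "prime p" "n \<le> N"
  shows "multiplicity p (fact n) = (\<Sum>a\<in>{1..N}. n div p ^ a)"
  using assms(2)
proof (induction n)
  case 0
  then show ?case by simp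
next
  case (Suc n)
  have p: "prime_elem p" "p \<ge> 2" using assms(1) prime_ge_2_nat by auto
  have "multiplicity p (fact (Suc n) :: nat) = multiplicity p (Suc n) + multiplicity p (fact n :: nat)"
    using p by (simp add: prime_elem_multiplicity_mult_distrib del: mult_Suc)
  also have "\<dots> = (\<Sum>a\<in>{1..N}. of_bool (p ^ a dvd Suc n) + n div p ^ a)"
    using Suc card_powers_dvd[OF assms(1), of "Suc n" N] by (simp add: sum.distrib)
  also have "\<dots> = (\<Sum>a\<in>{1..N}. Suc n div p ^ a)"
    by (intro sum.cong) (auto simp: div_Suc dvd_eq_mod_eq_0)
  finally show ?case .
qed

text \<open>In Legendre's formula for \<open>(2 n)! / (n!)\<^sup>2\<close> each exponent \<open>a\<close> contributes
  \<open>\<lfloor>2 n / p ^ a\<rfloor> - 2 \<lfloor>n / p ^ a\<rfloor>\<close>, which is at most 1, and 0 when \<open>p ^ a > 2 n\<close>.\<close>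

lemma prime_power_dividing_central_binomial:
  fixes p n :: nat
  assumes "prime p" "n \<ge> 1"
  shows "p ^ multiplicity p ((2 * n) choose n) \<le> 2 * n"
proof -
  let ?v = "multiplicity p ((2 * n) choose n)"
  have p: "prime_elem p" "p \<ge> 2" using assms(1) prime_ge_2_nat by auto
  have "(fact (2 * n) :: nat) = fact n * fact n * ((2 * n) choose n)"
    using binomial_fact_lemma[of n "2 * n"] by simp
  then have "multiplicity p (fact (2 * n) :: nat) = 2 * multiplicity p (fact n :: nat) + ?v"
    using p by (simp add: prime_elem_multiplicity_mult_distrib)
  then have "(\<Sum>a\<in>{1..2*n}. (2 * n) div p ^ a) = (\<Sum>a\<in>{1..2*n}. 2 * (n div p ^ a)) + ?v"
    using assms by (simp add: multiplicity_fact[of p _ "2 * n"] sum_distrib_left)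
  moreover have "(\<Sum>a\<in>{1..2*n}. (2 * n) div p ^ a)
      \<le> (\<Sum>a\<in>{1..2*n}. 2 * (n div p ^ a) + of_bool (p ^ a \<le> 2 * n))"
  proof (rule sum_mono)
    fix a
    define q where "q = p ^ a"
    have q: "q > 0" using p by (simp add: q_def)
    have "n < q * (n div q) + q"
      using q by (metis mult_div_mod_eq mod_less_divisor nat_add_left_cancel_less)
    then have "2 * n < q * (2 * (n div q) + 2)" by (simp add: algebra_simps)
    then have "(2 * n) div q < 2 * (n div q) + 2"
      by (simp add: q div_less_iff_less_mult mult.commute)
    then show "(2 * n) div p ^ a \<le> 2 * (n div p ^ a) + of_bool (p ^ a \<le> 2 * n)"
      by (cases "q \<le> 2 * n") (auto simp: q_def)
  qed
  ultimately have "?v \<le> (\<Sum>a\<in>{1..2*n}. of_bool (p ^ a \<le> 2 * n))"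
    by (simp add: sum.distrib)
  also have "\<dots> = card {a \<in> {1..2*n}. p ^ a \<le> 2 * n}"
    by (simp add: of_bool_def sum.If_cases Int_def)
  finally have v: "?v \<le> card {a \<in> {1..2*n}. p ^ a \<le> 2 * n}" .
  show ?thesis
  proof (rule ccontr)
    assume c: "\<not> ?thesis"
    have "{a \<in> {1..2*n}. p ^ a \<le> 2 * n} \<subseteq> {1..<?v}"
    proof clarify
      fix a assume a: "a \<in> {1..2*n}" "p ^ a \<le> 2 * n"
      have "a < ?v"
      proof (rule ccontr)
        assume "\<not> a < ?v"
        then have "p ^ ?v \<le> p ^ a" using p by (intro power_increasing) auto
        then show False using a c by simp
      qed
      then show "a \<in> {1..<?v}" using a by simp
    qed
    then have "card {a \<in> {1..2*n}. p ^ a \<le> 2 * n} \<le> ?v - 1"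
      by (metis card_mono card_atLeastLessThan finite_atLeastLessThan)
    then have "?v = 0" using v by simp
    then show False using c assms by simp
  qed
qed

lemma central_binomial_lower_bound:
  assumes "n \<ge> 1"
  shows "4 ^ n \<le> 2 * n * ((2 * n) choose n)"
  using assms
proof (induction n rule: nat_induct_at_least)
  case base
  then show ?case by simp
next
  case (Suc n)
  let ?C = "(2 * n) choose n"
  have sym: "Suc (2 * n) choose n = Suc (2 * n) choose Suc n"
    using binomial_symmetric[of n "Suc (2 * n)"] by (simp add: Suc_diff_le)
  have 1: "Suc n * (Suc (2 * n) choose Suc n) = Suc (2 * n) * ?C"
    by (rule Suc_times_binomial)
  have "Suc n * (Suc (Suc (2 * n)) choose Suc n) = Suc (Suc (2 * n)) * (Suc (2 * n) choose n)"
    by (rule Suc_times_binomial)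
  also have "\<dots> = 2 * (Suc n * (Suc (2 * n) choose Suc n))" unfolding sym by simp
  also have "\<dots> = 2 * (Suc (2 * n) * ?C)" using 1 by simp
  finally have "2 * Suc n * ((2 * Suc n) choose Suc n) = 4 * (Suc (2 * n) * ?C)" by simp
  moreover have "4 ^ Suc n \<le> 4 * (2 * n * ?C)" using Suc by simp
  ultimately show ?case by (simp add: algebra_simps)
qed

definition primes_upto :: "nat \<Rightarrow> nat set" where
  "primes_upto x = {p. prime p \<and> p \<le> x}"

lemma finite_primes_upto [simp]: "finite (primes_upto x)"
  by (rule finite_subset[of _ "{..x}"]) (auto simp: primes_upto_def)

lemma card_primes_upto_mono: "x \<le> y \<Longrightarrow> card (primes_upto x) \<le> card (primes_upto y)"
  by (intro card_mono) (auto simp: primes_upto_def)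

lemma central_binomial_le_prime_count:
  assumes "n \<ge> 1"
  shows "(2 * n) choose n \<le> (2 * n) ^ card (primes_upto (2 * n))"
proof -
  let ?C = "(2 * n) choose n"
  have C: "?C > 0" by simp
  have "prime_factors ?C \<subseteq> primes_upto (2 * n)"
  proof
    fix p assume "p \<in> prime_factors ?C"
    then have p: "prime p" "p dvd ?C" by (auto simp: in_prime_factors_iff)
    have "fact n * fact n * ?C = (fact (2 * n) :: nat)"
      using binomial_fact_lemma[of n "2 * n"] by simp
    then have "p dvd fact (2 * n)" using p(2) by (metis dvd_mult)
    then show "p \<in> primes_upto (2 * n)"
      using p(1) by (simp add: prime_dvd_fact_iff primes_upto_def)
  qed
  then have c: "card (prime_factors ?C) \<le> card (primes_upto (2 * n))" by (intro card_mono) auto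
  have "?C = (\<Prod>p\<in>prime_factors ?C. p ^ multiplicity p ?C)"
    using C by (intro prime_factorization_nat) auto
  also have "\<dots> \<le> (\<Prod>p\<in>prime_factors ?C. 2 * n)"
    using assms by (intro prod_mono) (auto intro: prime_power_dividing_central_binomial)
  also have "\<dots> = (2 * n) ^ card (prime_factors ?C)" by simp
  also have "\<dots> \<le> (2 * n) ^ card (primes_upto (2 * n))"
    using c assms by (intro power_increasing) auto
  finally show ?thesis .
qed

text \<open>The central binomial coefficient is at least \<open>4 ^ n / (2 n)\<close> and is a product of at most
  \<open>\<pi>(2 n)\<close> prime powers, each at most \<open>2 n\<close>.  Taking logarithms with \<open>n = \<lfloor>x / 2\<rfloor>\<close> gives the
  bound.\<close>

lemma chebyshev_lower_bound:
  assumes "x \<ge> 2"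
  shows "real x \<le> 5 * real (card (primes_upto x)) * ln (real x)"
proof -
  define n where "n = x div 2"
  let ?\<pi> = "card (primes_upto (2 * n))"
  have n: "n \<ge> 1" "2 * n \<le> x" "x \<le> 3 * n" using assms by (auto simp: n_def)
  \<comment> \<open>The factor \<open>2 n\<close> lost in the binomial bound counts like one more prime, which at most
     doubles the count because 2 is among the primes.\<close>
  have "2 \<in> primes_upto (2 * n)" using n by (simp add: primes_upto_def)
  then have pi: "?\<pi> \<ge> 1" using card_gt_0_iff[of "primes_upto (2 * n)"] by force
  have "(4::nat) ^ n \<le> 2 * n * (2 * n) ^ ?\<pi>"
    using central_binomial_lower_bound[OF n(1)] central_binomial_le_prime_count[OF n(1)]
    by (meson le_trans mult_le_mono2)
  also have "\<dots> = (2 * n) ^ (?\<pi> + 1)" by simp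
  finally have "real (4 ^ n) \<le> real ((2 * n) ^ (?\<pi> + 1))" by (rule of_nat_mono)
  then have "ln (4 ^ n) \<le> ln (real (2 * n) ^ (?\<pi> + 1))"
    using n by (subst ln_le_cancel_iff) auto
  then have "n * ln 4 \<le> ln (real (2 * n) ^ (?\<pi> + 1))" by (simp only: ln_realpow)
  also have "ln (real (2 * n) ^ (?\<pi> + 1)) = real (?\<pi> + 1) * ln (real (2 * n))"
    by (rule ln_realpow)
  finally have "n * ln 4 \<le> (real ?\<pi> + 1) * ln (2 * real n)"
    by (simp add: add.commute)
  also have "\<dots> \<le> (2 * real (card (primes_upto x))) * ln x"
    using pi card_primes_upto_mono[OF n(2)] n by (intro mult_mono) (auto simp: of_nat_le_iff)
  finally have "n * ln 4 \<le> 2 * real (card (primes_upto x)) * ln x" .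
  moreover have "ln (4::real) = 2 * ln 2" using ln_realpow[of 2 2] by simp
  moreover have "n * (2 * (2/3)) \<le> n * (2 * ln (2::real))"
    using ln2_ge_two_thirds by (intro mult_left_mono) auto
  ultimately have "n * (4/3) \<le> 2 * real (card (primes_upto x)) * ln x"
    by (simp add: mult_ac)
  moreover have "real x \<le> 3 * real n" using n by linarith
  ultimately show ?thesis by linarith
qed

lemma half_le_ln:
  assumes "k \<ge> 2"
  shows "1 / 2 \<le> ln (real k)"
proof -
  have "ln 2 \<le> ln (real k)" using assms by simp
  then show ?thesis using ln2_ge_two_thirds by linarith
qed

section \<open>Rough and smooth parts\<close>

definition rough :: "nat \<Rightarrow> nat \<Rightarrow> bool" where
  "rough k d \<longleftrightarrow> (\<forall>p. prime p \<longrightarrow> p < k \<longrightarrow> \<not> p dvd d)"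

definition primes_below :: "nat \<Rightarrow> nat set" where
  "primes_below k = {p. prime p \<and> p < k}"

definition smooth_part :: "nat \<Rightarrow> nat \<Rightarrow> nat" where
  "smooth_part k n = (\<Prod>p\<in>primes_below k. p ^ multiplicity p n)"

lemma finite_primes_below [simp]: "finite (primes_below k)"
  by (rule finite_subset[of _ "{..k}"]) (auto simp: primes_below_def)

lemma smooth_part_pos: "smooth_part k n > 0"
  unfolding smooth_part_def
  by (intro prod_pos) (auto simp: primes_below_def prime_gt_0_nat)

lemma multiplicity_smooth_part:
  assumes "prime p"
  shows "multiplicity p (smooth_part k n) = (if p < k then multiplicity p n else 0)"
proof -
  have "multiplicity p (\<Prod>q\<in>primes_below k. q ^ multiplicity q n)
      = (if p \<in> primes_below k then multiplicity p n else 0)"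
    by (rule multiplicity_prod_prime_powers) (auto simp: primes_below_def assms)
  then show ?thesis using assms by (auto simp: smooth_part_def primes_below_def)
qed

lemma smooth_part_dvd: "n > 0 \<Longrightarrow> smooth_part k n dvd n"
  using smooth_part_pos[of k n]
  by (intro multiplicity_le_imp_dvd) (auto simp: multiplicity_smooth_part)

lemma rough_cofactor:
  assumes "n > 0"
  shows "rough k (n div smooth_part k n)"
  unfolding rough_def
proof (intro allI impI)
  fix p assume p: "prime p" "p < k"
  let ?s = "smooth_part k n" and ?r = "n div smooth_part k n"
  have n: "n = ?s * ?r" using smooth_part_dvd[OF assms] by simp
  then have r: "?r > 0" using assms by (metis gr0I mult_0_right)
  have "multiplicity p n = multiplicity p ?s + multiplicity p ?r"
    using n r p smooth_part_pos[of k n]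
    by (metis prime_elem_multiplicity_mult_distrib less_not_refl prime_imp_prime_elem)
  then have "multiplicity p ?r = 0" using p by (simp add: multiplicity_smooth_part)
  then show "\<not> p dvd ?r" using p r
    by (metis less_not_refl not_prime_unit multiplicity_eq_zero_iff)
qed

lemma ln_smooth_part:
  "ln (smooth_part k n) = (\<Sum>p\<in>primes_below k. multiplicity p n * ln p)"
proof -
  have "ln (real (smooth_part k n)) = ln (\<Prod>p\<in>primes_below k. real p ^ multiplicity p n)"
    by (simp add: smooth_part_def)
  also have "\<dots> = (\<Sum>p\<in>primes_below k. ln (real p ^ multiplicity p n))"
    by (rule ln_prod) (auto simp: primes_below_def prime_gt_0_nat)
  also have "\<dots> = (\<Sum>p\<in>primes_below k. multiplicity p n * ln p)"
    by (intro sum.cong) (auto simp: ln_realpow primes_below_def prime_gt_0_nat)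
  finally show ?thesis .
qed

lemma rough_eq_1_or_ge:
  assumes "rough k r" "r \<ge> 1"
  shows "r = 1 \<or> k \<le> r"
proof (cases "r = 1")
  case False
  then obtain p where p: "prime p" "p dvd r" using prime_factor_nat by blast
  then have "k \<le> p" using assms unfolding rough_def by (meson not_le)
  also have "p \<le> r" using p assms by (intro dvd_imp_le) auto
  finally show ?thesis by simp
qed simp

lemma rough_coprime:
  assumes "rough k d" "0 < j" "j < k"
  shows "coprime d j"
proof (rule ccontr)
  assume "\<not> coprime d j"
  then obtain p where p: "prime p" "p dvd d" "p dvd j"
    using prime_factor_nat[of "gcd d j"] by (auto simp: coprime_iff_gcd_eq_1)
  then have "p \<le> j" using assms by (intro dvd_imp_le) auto
  then show False using assms p unfolding rough_def by auto
qed

text \<open>A rough number is coprime to every positive number below \<open>k\<close>, so in an equation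
  \<open>i d = j d'\<close> each of \<open>d\<close> and \<open>d'\<close> divides the other.  This is the reason for using rough
  differences.\<close>

lemma rough_mult_eq_imp_eq:
  assumes "rough k d" "rough k d'" "0 < i" "i < k" "0 < j" "j < k" "i * d = j * d'"
  shows "d = d'"
proof (rule dvd_antisym)
  have "d dvd j * d'" using assms(7) by (metis dvd_triv_right)
  then show "d dvd d'" using rough_coprime[OF assms(1,5,6)] by (metis coprime_dvd_mult_right_iff)
  have "d' dvd i * d" using assms(7) by simp
  then show "d' dvd d" using rough_coprime[OF assms(2,3,4)] by (metis coprime_dvd_mult_right_iff)
qed

section \<open>Reciprocals of rough numbers\<close>

text \<open>Let \<open>F\<close> be the sum.  Only multiples \<open>n = p t\<close> contribute, and they contribute
  \<open>(1 + multiplicity p t) / (p t)\<close>; this gives \<open>p F \<le> harm Y + F\<close>.\<close>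

lemma sum_multiplicity_div_le:
  fixes p :: nat
  assumes "prime p"
  shows "(\<Sum>n\<in>{1..Y}. multiplicity p n / n) \<le> 2 / p * harm Y"
proof -
  define F where "F = (\<Sum>n\<in>{1..Y}. multiplicity p n / n)"
  have p: "p \<ge> 2" using assms prime_ge_2_nat by auto
  have "F = (\<Sum>n\<in>{n\<in>{1..Y}. p dvd n}. multiplicity p n / n)"
    unfolding F_def by (rule sum.mono_neutral_right) (auto simp: not_dvd_imp_multiplicity_0)
  also have "{n\<in>{1..Y}. p dvd n} = (\<lambda>t. p * t) ` {1..Y div p}"
    using p by (auto simp: dvd_def image_iff less_eq_div_iff_mult_less_eq mult.commute Suc_le_eq)
  also have "(\<Sum>n\<in>(\<lambda>t. p * t) ` {1..Y div p}. multiplicity p n / n)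
      = (\<Sum>t\<in>{1..Y div p}. multiplicity p (p * t) / (p * t))"
    using p by (subst sum.reindex) (auto simp: inj_on_def)
  also have "\<dots> = (\<Sum>t\<in>{1..Y div p}. (1 + multiplicity p t) / (p * t))"
    using assms p by (intro sum.cong) (auto simp: multiplicity_times_same)
  also have "\<dots> \<le> (\<Sum>t\<in>{1..Y}. (1 + multiplicity p t) / (p * t))"
    by (rule sum_mono2) (auto intro: order.trans[OF _ div_le_dividend])
  also have "\<dots> = (harm Y + F) / p"
    by (simp add: F_def harm_def sum.distrib[symmetric] sum_divide_distrib field_simps)
  finally have "F * p \<le> harm Y + F" using p by (simp add: field_simps)
  moreover have "F \<ge> 0" unfolding F_def by (intro sum_nonneg) auto
  then have "F * 2 \<le> F * p" using p by (intro mult_left_mono) auto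
  ultimately have "F * p \<le> 2 * harm Y" by linarith
  then have "F \<le> 2 / p * harm Y" using p by (simp add: field_simps)
  then show ?thesis unfolding F_def .
qed

text \<open>Every prime \<open>p < k\<close> divides \<open>k!\<close> at least \<open>\<lfloor>k / p\<rfloor> \<ge> k / (2 p)\<close> times, while
  \<open>ln (k!) \<le> k ln k\<close>.  Mertens' theorem has the constant 1 in place of 2, but any constant
  serves here.\<close>

lemma sum_ln_prime_div_prime_le:
  assumes "k \<ge> 1"
  shows "(\<Sum>p\<in>primes_below k. ln p / p) \<le> 2 * ln k"
proof -
  have pf: "prime_factors (fact k :: nat) = primes_upto k"
    by (auto simp: in_prime_factors_iff prime_dvd_fact_iff primes_upto_def)
  have pb: "primes_below k \<subseteq> primes_upto k" by (auto simp: primes_below_def primes_upto_def)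
  have "(fact k :: nat) = (\<Prod>p\<in>primes_upto k. p ^ multiplicity p (fact k :: nat))"
    unfolding pf[symmetric] by (intro prime_factorization_nat) auto
  then have "ln (real (fact k)) = ln (\<Prod>p\<in>primes_upto k. real p ^ multiplicity p (fact k :: nat))"
    by (metis (mono_tags, lifting) of_nat_prod of_nat_power prod.cong)
  also have "\<dots> = (\<Sum>p\<in>primes_upto k. multiplicity p (fact k :: nat) * ln p)"
    by (subst ln_prod) (auto simp: ln_realpow primes_upto_def prime_gt_0_nat intro!: sum.cong)
  finally have e: "ln (real (fact k)) = (\<Sum>p\<in>primes_upto k. multiplicity p (fact k :: nat) * ln p)" .
  have "k / 2 * (\<Sum>p\<in>primes_below k. ln p / p) = (\<Sum>p\<in>primes_below k. k / (2 * p) * ln p)"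
    by (simp add: sum_distrib_left field_simps)
  also have "\<dots> \<le> (\<Sum>p\<in>primes_below k. multiplicity p (fact k :: nat) * ln p)"
  proof (intro sum_mono mult_right_mono)
    fix p assume "p \<in> primes_below k"
    then have p: "prime p" "p < k" by (auto simp: primes_below_def)
    then have p2: "p \<ge> 2" by (simp add: prime_ge_2_nat)
    then show "ln (real p) \<ge> 0" by simp
    have "k < p * (k div p) + p"
      using p2 by (metis mult_div_mod_eq mod_less_divisor nat_add_left_cancel_less
          less_le_trans pos2)
    also have "\<dots> \<le> p * (k div p) + p * (k div p)"
      using p p2 by (intro add_left_mono) (auto simp: less_eq_div_iff_mult_less_eq Suc_le_eq div_greater_zero_iff)
    finally have "real k \<le> real (2 * p * (k div p))" by (intro of_nat_mono) simp
    then have "k / (2 * p) \<le> real (k div p)" using p2 by (simp add: field_simps)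
    also have "k div p = (\<Sum>a\<in>{1}. k div p ^ a)" by simp
    also have "(\<Sum>a\<in>{1}. k div p ^ a) \<le> (\<Sum>a\<in>{1..k}. k div p ^ a)"
      using assms by (intro sum_mono2) auto
    also have "\<dots> = multiplicity p (fact k :: nat)"
      using multiplicity_fact[OF p(1), of k k] by simp
    finally show "k / (2 * p) \<le> real (multiplicity p (fact k :: nat))" by simp
  qed
  also have "\<dots> \<le> (\<Sum>p\<in>primes_upto k. multiplicity p (fact k :: nat) * ln p)"
    using pb by (intro sum_mono2) (auto simp: primes_upto_def intro!: mult_nonneg_nonneg ln_ge_zero dest: prime_ge_1_nat)
  also have "\<dots> = ln (real (fact k))" using e by simp
  also have "\<dots> \<le> ln (real k ^ k)"
    using assms fact_le_power[of k, where 'a = real] by (subst ln_le_cancel_iff) auto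
  also have "\<dots> = k * ln k" using assms by (simp add: ln_realpow)
  finally show ?thesis using assms by (simp add: field_simps)
qed

lemma harm_le_one_plus_ln: "n \<ge> 1 \<Longrightarrow> harm n \<le> 1 + ln (real n)"
proof -
  assume "n \<ge> 1"
  then obtain m where "n = Suc m" by (cases n) auto
  then show ?thesis
    using decseqD[OF decseq_harm_diff_ln, of 0 m] by (simp add: harm_expand)
qed

text \<open>Exchange the order of summation: the prime \<open>p < k\<close> contributes at most
  \<open>ln p * (2 / p) * harm Y\<close>.\<close>

lemma mean_ln_smooth_part_le:
  assumes "k \<ge> 1"
  shows "(\<Sum>n\<in>{1..Y}. ln (smooth_part k n) / n) \<le> 4 * ln k * harm Y"
proof -
  have "(\<Sum>n\<in>{1..Y}. ln (smooth_part k n) / n)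
      = (\<Sum>n\<in>{1..Y}. \<Sum>p\<in>primes_below k. ln p * (multiplicity p n / n))"
    by (simp add: ln_smooth_part sum_divide_distrib mult.commute)
  also have "\<dots> = (\<Sum>p\<in>primes_below k. ln p * (\<Sum>n\<in>{1..Y}. multiplicity p n / n))"
    by (subst sum.swap) (simp add: sum_distrib_left)
  also have "\<dots> \<le> (\<Sum>p\<in>primes_below k. ln p * (2 / p * harm Y))"
  proof (intro sum_mono mult_left_mono)
    fix p assume "p \<in> primes_below k"
    then have p: "prime p" by (simp add: primes_below_def)
    then show "(\<Sum>n\<in>{1..Y}. multiplicity p n / n) \<le> 2 / p * harm Y"
      by (rule sum_multiplicity_div_le)
    show "0 \<le> ln (real p)" using prime_ge_1_nat[OF p] by simp
  qed
  also have "\<dots> = 2 * harm Y * (\<Sum>p\<in>primes_below k. ln p / p)"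
    by (simp add: sum_distrib_left field_simps)
  also have "\<dots> \<le> 2 * harm Y * (2 * ln k)"
    using assms by (intro mult_left_mono sum_ln_prime_div_prime_le) (auto simp: harm_nonneg)
  finally show ?thesis by (simp only: mult_ac)
qed

text \<open>Since \<open>8 ln k\<close> is twice the bound for the mean of the logarithm of the smooth part, Markov's
  inequality shows that the numbers with smooth part above \<open>k ^ 8\<close> carry at most half of the
  weight \<open>harm Y\<close>.  The others embed into pairs of a rough
  number up to \<open>Y\<close> and an arbitrary number up to \<open>k ^ 8\<close>.\<close>

lemma sum_inverse_rough_ge:
  assumes "k \<ge> 2"
  shows "harm Y \<le> 20 * ln k * (\<Sum>r | r \<in> {1..Y} \<and> rough k r. 1 / real r)"
proof -
  define G where "G = (\<Sum>r | r \<in> {1..Y} \<and> rough k r. 1 / real r)"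
  define A where "A = {n \<in> {1..Y}. smooth_part k n \<le> k ^ 8}"
  define s where "s = smooth_part k"
  have lnk: "1 / 2 \<le> ln (real k)" using assms by (rule half_le_ln)
  have "8 * ln k * (\<Sum>n\<in>{1..Y} - A. 1 / real n) \<le> (\<Sum>n\<in>{1..Y} - A. ln (s n) / n)"
    unfolding sum_distrib_left
  proof (rule sum_mono)
    fix n assume "n \<in> {1..Y} - A"
    then have "k ^ 8 < s n" by (auto simp: A_def s_def)
    then have "real (k ^ 8) \<le> s n" by (intro of_nat_mono) simp
    then have "ln (real k ^ 8) \<le> ln (real (s n))" 
      using assms smooth_part_pos[of k n] by (subst ln_le_cancel_iff) (auto simp: s_def)
    then have "8 * ln k \<le> ln (s n)" using assms by (simp add: ln_realpow)
    then show "8 * ln k * (1 / real n) \<le> ln (s n) / n" by (simp add: divide_right_mono)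
  qed
  also have "\<dots> \<le> (\<Sum>n\<in>{1..Y}. ln (s n) / n)"
    by (rule sum_mono2) (use smooth_part_pos in \<open>auto simp: s_def Suc_le_eq\<close>)
  also have "\<dots> \<le> 4 * ln k * harm Y"
    unfolding s_def using assms by (intro mean_ln_smooth_part_le) auto
  finally have "ln k * (2 * (\<Sum>n\<in>{1..Y} - A. 1 / real n)) \<le> ln k * harm Y"
    by (simp add: mult_ac)
  then have "2 * (\<Sum>n\<in>{1..Y} - A. 1 / real n) \<le> harm Y"
    using lnk by (subst (asm) mult_le_cancel_left_pos) auto
  moreover have "harm Y = (\<Sum>n\<in>{1..Y} - A. 1 / real n) + (\<Sum>n\<in>A. 1 / real n)"
    unfolding harm_def by (subst sum.subset_diff[of A]) (auto simp: A_def inverse_eq_divide)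
  ultimately have "harm Y \<le> 2 * (\<Sum>n\<in>A. 1 / real n)" by linarith
  also have "(\<Sum>n\<in>A. 1 / real n) \<le> (\<Sum>(r, t)\<in>{r \<in> {1..Y}. rough k r} \<times> {1..k ^ 8}. (1 / real r) * (1 / real t))"
  proof (rule sum_le_included[where i = "\<lambda>(r, t). r * t"])
    show "\<forall>n\<in>A. \<exists>x\<in>{r \<in> {1..Y}. rough k r} \<times> {1..k ^ 8}.
        (case x of (r, t) \<Rightarrow> r * t) = n \<and> 1 / real n \<le> (case x of (r, t) \<Rightarrow> 1 / real r * (1 / real t))"
    proof
      fix n assume n: "n \<in> A"
      define r where "r = n div s n"
      have e: "n = r * s n" using n smooth_part_dvd[of n k] by (auto simp: r_def s_def A_def)
      have "r > 0" "s n > 0" using e n by (auto simp: A_def intro!: gr0I)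
      moreover have "r \<le> n" by (simp add: r_def)
      moreover have "rough k r" using n rough_cofactor[of n k] by (auto simp: r_def s_def A_def)
      ultimately have m: "(r, s n) \<in> {r \<in> {1..Y}. rough k r} \<times> {1..k ^ 8}"
        using n by (auto simp: A_def s_def)
      show "\<exists>x\<in>{r \<in> {1..Y}. rough k r} \<times> {1..k ^ 8}.
        (case x of (r, t) \<Rightarrow> r * t) = n \<and> 1 / real n \<le> (case x of (r, t) \<Rightarrow> 1 / real r * (1 / real t))"
        by (rule bexI[OF _ m]) (use e in \<open>simp del: of_nat_mult add: of_nat_mult[symmetric]\<close>)
    qed
  qed (auto simp: A_def)
  also have "\<dots> = G * harm (k ^ 8)"
    by (simp add: G_def harm_def sum.cartesian_product[symmetric] sum_product inverse_eq_divide)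
  also have "\<dots> \<le> G * (10 * ln k)"
  proof (rule mult_left_mono)
    have "harm (k ^ 8) \<le> 1 + ln (real (k ^ 8))"
      using assms by (intro harm_le_one_plus_ln) auto
    also have "\<dots> \<le> 10 * ln k" using lnk assms by (simp add: ln_realpow)
    finally show "harm (k ^ 8) \<le> 10 * ln k" .
    show "0 \<le> G" by (simp add: G_def sum_nonneg)
  qed
  finally show ?thesis by (simp add: G_def mult_ac)
qed

section \<open>Counting rough numbers\<close>

lemma integer_cube_root:
  fixes X :: nat
  obtains Y where "Y ^ 3 \<le> X" "X < (Y + 1) ^ 3"
proof -
  define Y where "Y = (LEAST y. X < (y + 1) ^ 3)"
  have "X + 1 \<le> (X + 1) ^ 3" by (rule self_le_power) auto
  then have "X < (X + 1) ^ 3" by simp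
  then have 1: "X < (Y + 1) ^ 3" unfolding Y_def by (rule LeastI)
  have "Y ^ 3 \<le> X"
  proof (cases Y)
    case (Suc y)
    then have "\<not> X < (y + 1) ^ 3" using not_less_Least[of y "\<lambda>y. X < (y + 1) ^ 3"] by (simp add: Y_def)
    then show ?thesis using Suc by simp
  qed simp
  then show ?thesis using 1 that by blast
qed

lemma ln_le_two_sqrt: "x \<ge> 1 \<Longrightarrow> ln x \<le> 2 * sqrt x"
proof -
  assume x: "x \<ge> 1"
  have "ln x = ln (sqrt x ^ 2)" using x by simp
  also have "\<dots> = 2 * ln (sqrt x)" using x by (subst ln_realpow) auto
  also have "ln (sqrt x) \<le> sqrt x" using x ln_le_minus_one[of "sqrt x"] by auto
  finally show ?thesis by simp
qed

text \<open>The number of primes up to \<open>Y\<^sup>2\<close> is of order \<open>Y\<^sup>2 / ln Y\<close>, so primes up to \<open>Y\<close> are a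
  minority among them for large \<open>Y\<close>.  What is needed is \<open>20 ln Y \<le> Y\<close>, and \<open>ln Y \<le> 2 \<surd>Y\<close>
  gives this from \<open>Y = 40\<^sup>2\<close> on.\<close>

lemma prime_count_square_ge:
  assumes "Y \<ge> 1600"
  shows "2 * Y \<le> card (primes_upto (Y ^ 2))"
proof -
  have "40 = sqrt (40 ^ 2)" by simp
  also have "\<dots> \<le> sqrt Y" using assms by (intro real_sqrt_le_mono) simp
  finally have "40 * sqrt Y \<le> sqrt Y * sqrt Y" by (intro mult_right_mono) auto
  then have "20 * ln Y \<le> Y" using ln_le_two_sqrt[of Y] assms by simp
  then have "20 * ln Y * Y \<le> real Y * Y" by (intro mult_right_mono) auto
  moreover have "Y ^ 2 \<ge> 2" using assms self_le_power[of Y 2] by linarith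
  then have "real (Y ^ 2) \<le> 5 * real (card (primes_upto (Y ^ 2))) * ln (real (Y ^ 2))"
    by (rule chebyshev_lower_bound)
  then have "real Y * Y \<le> 10 * real (card (primes_upto (Y ^ 2))) * ln Y"
    using assms ln_realpow[of "real Y" 2] by (simp add: power2_eq_square)
  ultimately have "ln Y * (20 * Y) \<le> ln Y * (10 * real (card (primes_upto (Y ^ 2))))"
    by (simp add: mult_ac)
  moreover have "ln Y > 0" using assms by simp
  ultimately show ?thesis by (simp only: mult_le_cancel_left_pos)
qed

text \<open>If there were fewer primes, Chebyshev's bound would give \<open>X \<le> 10 k ln X\<close>.  A first use of this
  with \<open>ln X \<le> 2 \<surd>X\<close> shows that \<open>X\<close> is polynomial in \<open>k\<close>; hence \<open>ln X\<close> is \<open>O(ln k)\<close>, and a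
  second use contradicts the size of \<open>X\<close>.\<close>

lemma prime_count_ge_twice:
  fixes k X :: nat
  assumes "k \<ge> 2" "real X \<ge> 10 ^ 3 * k * ln k"
  shows "2 * k \<le> card (primes_upto X)"
proof (rule ccontr)
  assume "\<not> ?thesis"
  then have c: "real (card (primes_upto X)) \<le> 2 * k" by linarith
  have lnk: "1 / 2 \<le> ln (real k)" using assms(1) by (rule half_le_ln)
  have klnk: "2 * (1 / 2) \<le> real k * ln k" using lnk assms(1) by (intro mult_mono) auto
  have "2 \<le> real X" using klnk assms(2) by (simp add: mult.assoc)
  then have X: "X \<ge> 2" by simp
  have "real X \<le> 5 * real (card (primes_upto X)) * ln X" using X by (rule chebyshev_lower_bound)
  also have "\<dots> \<le> 5 * (2 * k) * ln X" using c X by (intro mult_mono) auto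
  finally have 1: "real X \<le> 10 * k * ln X" by simp
  also have "\<dots> \<le> 10 * k * (2 * sqrt X)" using X by (intro mult_left_mono ln_le_two_sqrt) auto
  finally have "sqrt X * sqrt X \<le> (20 * k) * sqrt X" by simp
  then have "sqrt X \<le> 20 * k" using X by (subst (asm) mult_le_cancel_right_pos) auto
  then have "sqrt X ^ 2 \<le> (20 * real k) ^ 2" by (intro power_mono) auto
  then have "real X \<le> 400 * real k ^ 2" by (simp add: power_mult_distrib)
  also have "\<dots> \<le> real k ^ 9 * real k ^ 2"
    using power_mono[of 2 "real k" 9] assms(1) by (intro mult_right_mono) auto
  finally have "real X \<le> real k ^ 11" by (simp add: power_add[symmetric])
  then have "ln X \<le> ln (real k ^ 11)" using X assms(1) by (subst ln_le_cancel_iff) auto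
  then have "ln X \<le> 11 * ln k" using assms(1) by (simp add: ln_realpow)
  then have "10 * real k * ln X \<le> 10 * real k * (11 * ln k)" by (intro mult_left_mono) auto
  then have "real X \<le> 110 * (k * ln k)" using 1 by simp
  moreover have "10 ^ 3 * (k * ln k) \<le> real X" using assms(2) by (simp add: mult.assoc)
  ultimately show False using klnk by simp
qed

text \<open>The rough numbers counted are the products \<open>r p\<close> with \<open>r\<close> in \<open>R\<close> and \<open>p\<close> in \<open>T r\<close>.  Since
  \<open>p\<close> is a prime exceeding every element of \<open>R\<close>, the product determines both factors.  Cutting
  \<open>r\<close> off at the cube root keeps \<open>X / r \<ge> Y\<^sup>2\<close>, so excluding the primes up to \<open>W\<close> costs at most
  half of the primes up to \<open>X / r\<close>, and \<open>ln Y\<close> is still comparable to \<open>ln X\<close>.  The two lower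
  bounds then combine so that \<open>ln X\<close> cancels.  The factor \<open>10 ^ 10\<close> makes \<open>X\<close> exceed
  \<open>1600 ^ 3\<close>, so that \<open>Y\<close> is large enough for \<open>prime_count_square_ge\<close>.\<close>

lemma card_rough_ge:
  fixes k X :: nat
  assumes k: "k \<ge> 2" and X: "real X \<ge> 10 ^ 10 * k * ln k"
  shows "real X \<le> 1200 * ln k * card {d \<in> {1..X}. rough k d}"
proof -
  obtain Y where Y: "Y ^ 3 \<le> X" "X < (Y + 1) ^ 3" by (rule integer_cube_root)
  define R where "R = {r \<in> {1..Y}. rough k r}"
  define W where "W = max Y k"
  define T where "T = (\<lambda>r. primes_upto (X div r) - {..W})"
  define S where "S = {d \<in> {1..X}. rough k d}"
  define G where "G = (\<Sum>r\<in>R. 1 / real r)"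
  have lnk: "1 / 2 \<le> ln (real k)" using k by (rule half_le_ln)
  have klnk: "2 * (1 / 2) \<le> real k * ln k" using lnk k by (intro mult_mono) auto
  have X10: "real X \<ge> 10 ^ 10" using X klnk by (simp add: mult.assoc)
  have Y1600: "Y \<ge> 1600"
  proof (rule ccontr)
    assume "\<not> ?thesis"
    then have "(Y + 1) ^ 3 \<le> 1600 ^ 3" by (intro power_mono) auto
    then have "real X \<le> 1600 ^ 3" using Y(2) by simp
    then show False using X10 by simp
  qed
  have lnX: "ln X > 0" using X10 by simp
  have fR: "finite R" by (simp add: R_def)
  have fT: "finite (T r)" for r by (simp add: T_def)
  have reciprocal: "real X * (1 / real r) \<le> 20 * ln X * card (T r)" if r: "r \<in> R" for r
  proof -
    define x where "x = X div r"
    have r1: "1 \<le> r" "r \<le> Y" "rough k r" using r by (auto simp: R_def)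
    have "Y ^ 2 * r \<le> Y ^ 2 * Y" using r1 by (intro mult_left_mono) auto
    also have "\<dots> \<le> X" using Y(1) by (simp add: power2_eq_square power3_eq_cube)
    finally have xY: "Y ^ 2 \<le> x" using r1 by (simp add: x_def less_eq_div_iff_mult_less_eq)
    have x2: "x \<ge> 2" using xY Y1600 self_le_power[of Y 2] by linarith
    have 1: "2 * Y \<le> card (primes_upto x)"
      using prime_count_square_ge[OF Y1600] card_primes_upto_mono[OF xY] by linarith
    \<comment> \<open>For \<open>r > 1\<close> roughness forces \<open>k \<le> r \<le> Y\<close>; only for \<open>r = 1\<close> can \<open>k\<close> exceed \<open>Y\<close>, and
       there the size of \<open>X\<close> compared with \<open>k ln k\<close> is needed.\<close>
    have "2 * k \<le> card (primes_upto x)"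
    proof (cases "r = 1")
      case True
      have "10 ^ 3 * (real k * ln k) \<le> 10 ^ 10 * (real k * ln k)"
        using klnk by (intro mult_right_mono) auto
      then have "real X \<ge> 10 ^ 3 * k * ln k" using X by simp
      then show ?thesis using True prime_count_ge_twice[OF k] by (simp add: x_def)
    next
      case False
      then have "k \<le> Y" using rough_eq_1_or_ge[OF r1(3,1)] r1 by simp
      then show ?thesis using 1 by linarith
    qed
    then have W: "2 * W \<le> card (primes_upto x)" using 1 by (simp add: W_def)
    have "primes_upto x \<subseteq> T r \<union> {1..W}"
      by (auto simp: T_def x_def primes_upto_def Suc_le_eq prime_gt_0_nat)
    then have "card (primes_upto x) \<le> card (T r \<union> {1..W})" by (intro card_mono) (auto simp: fT)
    also have "\<dots> \<le> card (T r) + W" using card_Un_le[of "T r" "{1..W}"] by simp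
    finally have c: "card (primes_upto x) \<le> 2 * card (T r)" using W by linarith
    have "X < r * x + r"
      unfolding x_def using r1
      by (metis mult_div_mod_eq mod_less_divisor nat_add_left_cancel_less less_le_trans zero_less_one)
    also have "\<dots> \<le> r * x + r * x" using x2 by simp
    finally have "real X \<le> real (2 * (r * x))" by (intro of_nat_mono) simp
    then have "real X * (1 / r) \<le> 2 * real x" using r1 by (simp add: field_simps)
    also have "\<dots> \<le> 2 * (5 * real (card (primes_upto x)) * ln x)"
      by (intro mult_left_mono chebyshev_lower_bound x2) simp
    also have "\<dots> \<le> 2 * (5 * real (2 * card (T r)) * ln X)"
      using c x2 X10 by (intro mult_left_mono mult_mono of_nat_mono) (auto simp: x_def)
    finally show ?thesis by (simp add: mult_ac)
  qed
  have inj: "inj_on (\<lambda>(r, p). r * p) (Sigma R T)"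
  proof (rule inj_onI, clarify)
    fix r p r' p'
    assume a: "r \<in> R" "p \<in> T r" "r' \<in> R" "p' \<in> T r'" "r * p = r' * p'"
    have p: "prime p" "prime p'" "Y < p" "r' \<le> Y" "r' \<ge> 1"
      using a by (auto simp: T_def W_def R_def primes_upto_def)
    have "p dvd r' * p'" using a(5) by (metis dvd_triv_right)
    then have "p dvd r' \<or> p dvd p'" using p by (simp add: prime_dvd_mult_iff)
    moreover have "\<not> p dvd r'" using p by (auto dest: dvd_imp_le)
    ultimately have "p = p'" using p by (simp add: primes_dvd_imp_eq)
    then show "r = r' \<and> p = p'" using a(5) p by (auto simp: prime_gt_0_nat)
  qed
  have im: "(\<lambda>(r, p). r * p) ` Sigma R T \<subseteq> S"
  proof clarify
    fix r p assume a: "r \<in> R" "p \<in> T r"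
    have p: "prime p" "k < p" "p \<le> X div r" "1 \<le> r" "rough k r"
      using a by (auto simp: T_def W_def R_def primes_upto_def)
    have "r * p \<le> X" using p by (simp add: less_eq_div_iff_mult_less_eq mult.commute)
    moreover have "1 \<le> r * p" using p prime_ge_1_nat[of p] by simp
    moreover have "rough k (r * p)"
      unfolding rough_def
    proof (intro allI impI notI)
      fix q assume q: "prime q" "q < k" "q dvd r * p"
      then have "q dvd r \<or> q = p" using p by (metis prime_dvd_mult_iff primes_dvd_imp_eq)
      then show False using p q by (auto simp: rough_def)
    qed
    ultimately show "r * p \<in> S" by (simp add: S_def)
  qed
  have "card (Sigma R T) \<le> card S" by (rule card_inj_on_le[OF inj im]) (simp add: S_def)
  then have cS: "(\<Sum>r\<in>R. card (T r)) \<le> card S" using fR fT by simp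
  have "real X * G \<le> (\<Sum>r\<in>R. 20 * ln X * card (T r))"
    unfolding G_def sum_distrib_left by (intro sum_mono reciprocal)
  also have "\<dots> = 20 * ln X * real (\<Sum>r\<in>R. card (T r))" by (simp add: sum_distrib_left)
  also have "\<dots> \<le> 20 * ln X * card S"
    using cS lnX by (intro mult_left_mono of_nat_mono) auto
  finally have XG: "real X * G \<le> 20 * ln X * card S" .
  have "real X \<le> real ((Y + 1) ^ 3)" using Y(2) by (intro of_nat_mono) simp
  then have "ln X \<le> ln ((real Y + 1) ^ 3)"
    using X10 by (subst ln_le_cancel_iff) (auto simp: add.commute)
  also have "\<dots> = 3 * ln (real Y + 1)" by (subst ln_realpow) auto
  also have "\<dots> \<le> 3 * harm Y" using ln_le_harm[of Y] by simp
  also have "harm Y \<le> 20 * ln k * G"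
    using sum_inverse_rough_ge[OF k, of Y] by (simp add: G_def R_def)
  finally have "ln X \<le> 60 * ln k * G" by simp
  then have "real X * ln X \<le> real X * (60 * ln k * G)" by (intro mult_left_mono) auto
  also have "\<dots> = 60 * ln k * (real X * G)" by simp
  also have "\<dots> \<le> 60 * ln k * (20 * ln X * card S)"
    using XG lnk by (intro mult_left_mono) auto
  finally have "real X * ln X \<le> (1200 * ln k * card S) * ln X" by (simp add: mult_ac)
  then show ?thesis unfolding S_def[symmetric] using lnX by (simp only: mult_le_cancel_right_pos)
qed

section \<open>Progressions with rough difference\<close>

text \<open>If no progression with first term in \<open>{1..k * X}\<close> and rough difference is rainbow, send
  \<open>(a, d)\<close> to a pair of its terms with equal color together with the index of the first of them.
  The difference of the pair determines \<open>d\<close> by uniqueness of the rough factor, and then the index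
  determines \<open>a\<close>, so there are at most \<open>n m k\<close> such progressions.\<close>

lemma forces_rainbow_ap_if_many_rough:
  assumes k: "k \<ge> 1" and many: "2 * m * k < card {d \<in> {1..X}. rough k d}"
  shows "forces_rainbow_ap m k (2 * k * X)"
  unfolding forces_rainbow_ap_def
proof (intro allI impI, rule ccontr)
  fix col :: "nat \<Rightarrow> nat"
  define n where "n = 2 * k * X"
  define S where "S = {d \<in> {1..X}. rough k d}"
  assume b: "bounded_coloring m (2 * k * X) col"
    and none: "\<not> (\<exists>A\<subseteq>{1..2 * k * X}. arith_prog k A \<and> rainbow col A)"
  define Q where "Q = (SIGMA x:{1..n}. {y \<in> {1..n}. col y = col x} \<times> {..<k})"
  have X: "X > 0" using many by (cases X) auto
  have in_n: "a + i * d \<in> {1..n}" if "a \<in> {1..k * X}" "d \<in> S" "i < k" for a d i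
  proof -
    have "i * d \<le> k * X" using that by (intro mult_le_mono) (auto simp: S_def)
    then show ?thesis using that by (auto simp: n_def)
  qed
  have "\<exists>i j. i < j \<and> j < k \<and> col (a + i * d) = col (a + j * d)"
    if ad: "a \<in> {1..k * X}" "d \<in> S" for a d
  proof -
    let ?A = "(\<lambda>i. a + i * d) ` {..<k}"
    have "?A \<subseteq> {1..n}" using in_n[OF ad] by blast
    moreover have "arith_prog k ?A" using ad by (auto simp: arith_prog_def S_def)
    ultimately have "\<not> inj_on col ?A" using none by (auto simp: rainbow_def n_def)
    then obtain i j where "i < k" "j < k" "i \<noteq> j" "col (a + i * d) = col (a + j * d)"
      by (auto simp: inj_on_def)
    then show ?thesis by (metis nat_neq_iff)
  qed
  then obtain I J where IJ: "\<And>a d. a \<in> {1..k * X} \<Longrightarrow> d \<in> S \<Longrightarrow>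
      I a d < J a d \<and> J a d < k \<and> col (a + I a d * d) = col (a + J a d * d)"
    by metis
  let ?f = "\<lambda>(a, d). (a + I a d * d, a + J a d * d, I a d)"
  have "inj_on ?f ({1..k * X} \<times> S)"
  proof (rule inj_onI, clarify)
    fix a d a' d'
    assume ad: "a \<in> {1..k * X}" "d \<in> S" "a' \<in> {1..k * X}" "d' \<in> S"
      and e: "a + I a d * d = a' + I a' d' * d'" "a + J a d * d = a' + J a' d' * d'"
        "I a d = I a' d'"
    have ij: "I a d < J a d" "J a d < k" "I a' d' < J a' d'" "J a' d' < k"
      using IJ[OF ad(1,2)] IJ[OF ad(3,4)] by auto
    have "(J a d - I a d) * d = (J a' d' - I a' d') * d'"
      using e(1,2) ij by (simp only: diff_mult_distrib)
    then have "d = d'"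
      by (rule rough_mult_eq_imp_eq[of k, rotated 6]) (use ad ij in \<open>auto simp: S_def\<close>)
    then show "a = a' \<and> d = d'" using e by simp
  qed
  moreover have "?f ` ({1..k * X} \<times> S) \<subseteq> Q"
  proof clarify
    fix a d assume ad: "a \<in> {1..k * X}" "d \<in> S"
    have ij: "I a d < k" "J a d < k" using IJ[OF ad] by auto
    show "(a + I a d * d, a + J a d * d, I a d) \<in> Q"
      using in_n[OF ad ij(1)] in_n[OF ad ij(2)] IJ[OF ad] ij by (simp add: Q_def)
  qed
  moreover have "finite Q" by (simp add: Q_def)
  ultimately have "card ({1..k * X} \<times> S) \<le> card Q" by (rule card_inj_on_le)
  also have "card Q = (\<Sum>x\<in>{1..n}. card ({y \<in> {1..n}. col y = col x} \<times> {..<k}))"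
    unfolding Q_def by (rule card_SigmaI) auto
  also have "\<dots> \<le> (\<Sum>x\<in>{1..n}. m * k)"
  proof (rule sum_mono)
    fix x
    have "card {y \<in> {1..n}. col y = col x} \<le> m"
      using b unfolding bounded_coloring_def n_def by blast
    then show "card ({y \<in> {1..n}. col y = col x} \<times> {..<k}) \<le> m * k"
      by (simp add: card_cartesian_product)
  qed
  finally have "(k * X) * card S \<le> (k * X) * (2 * m * k)"
    by (simp add: card_cartesian_product n_def algebra_simps)
  then have "card S \<le> 2 * m * k" using X k by (subst (asm) mult_le_cancel1) auto
  then show False using many by (simp add: S_def)
qed

theorem corollary2p3:
  shows "\<exists>c :: real. \<forall>m k :: nat. m \<ge> 1 \<longrightarrow> k \<ge> 2 \<longrightarrow>
    real (sr m k) \<le> c * real m * (real k)\<^sup>2 * ln (real k)"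
proof (intro exI[of _ "2 * 10 ^ 10 + 2"] allI impI)
  fix m k :: nat
  assume m: "m \<ge> 1" and k: "k \<ge> 2"
  define L where "L = real m * k * ln k"
  \<comment> \<open>The density \<open>1 / (1200 ln k)\<close> of the rough numbers turns this \<open>X\<close> into far more than
     \<open>2 m k\<close> differences; the factor \<open>10 ^ 10\<close> is the one required by \<open>card_rough_ge\<close>.\<close>
  define X where "X = nat \<lceil>10 ^ 10 * L\<rceil>"
  have lnk: "1 / 2 \<le> ln (real k)" using k by (rule half_le_ln)
  have "1 * (2 * (1 / 2)) \<le> real m * (real k * ln k)" using m k lnk by (intro mult_mono) auto
  then have L: "L \<ge> 1" by (simp add: L_def)
  have Xl: "10 ^ 10 * L \<le> X" unfolding X_def by (rule real_nat_ceiling_ge)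
  have Xu: "X \<le> 10 ^ 10 * L + 1"
    unfolding X_def using L of_int_ceiling_le_add_one[of "10 ^ 10 * L"] by simp
  have "1 * (real k * ln k) \<le> real m * (real k * ln k)" using m lnk by (intro mult_right_mono) auto
  then have "10 ^ 10 * k * ln k \<le> real X" using Xl by (simp add: L_def)
  then have "real X \<le> 1200 * ln k * card {d \<in> {1..X}. rough k d}" by (rule card_rough_ge[OF k])
  then have "ln k * (10 ^ 10 * real (m * k)) \<le> ln k * (1200 * card {d \<in> {1..X}. rough k d})"
    using Xl by (simp add: L_def mult_ac)
  then have "10 ^ 10 * real (m * k) \<le> 1200 * real (card {d \<in> {1..X}. rough k d})"
    using lnk by (subst (asm) mult_le_cancel_left_pos) auto
  moreover have "real (m * k) \<ge> 1" using m k by (simp add: of_nat_mult[symmetric] Suc_le_eq del: of_nat_mult)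
  ultimately have "real (2 * m * k) < real (card {d \<in> {1..X}. rough k d})"
    by (simp add: mult.commute)
  then have "2 * m * k < card {d \<in> {1..X}. rough k d}" by (simp only: of_nat_less_iff)
  then have "forces_rainbow_ap m k (2 * k * X)" using k by (intro forces_rainbow_ap_if_many_rough) auto
  then have "sr m k \<le> 2 * k * X" unfolding sr_def by (rule Least_le)
  then have "real (sr m k) \<le> real (2 * k * X)" by (rule of_nat_mono)
  also have "\<dots> = 2 * real k * X" by simp
  also have "\<dots> \<le> 2 * real k * (10 ^ 10 * L + L)" using Xu L by (intro mult_left_mono) auto
  also have "\<dots> = (2 * 10 ^ 10 + 2) * real m * (real k)\<^sup>2 * ln (real k)"
    by (simp add: L_def power2_eq_square algebra_simps)
  finally show "real (sr m k) \<le> (2 * 10 ^ 10 + 2) * real m * (real k)\<^sup>2 * ln (real k)" .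
qed

end
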